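(* Let $(L_n)_{n\in\mathbb{N}}$ be a sequence of operators with $L_n\in\Lambda$ for every $n\in\mathbb{N}$. With $M_n^k$, $\alpha_n$, $\eta_n$, $G_n$ as defined in the context, assume that, as $n\to\infty$, $$M_n^4(x)=\mathrm{o}(M_n^2(x))\quad\text{uniformly with regard to } x\in[0,1],$$ (i.e. there is a sequence $\beta_n>0$, $\beta_n\to0$, with $M_n^4(x)\le\beta_n M_n^2(x)$ for all $x\in[0,1]$ and $n\in\mathbb{N}$), and $$\eta_n=\mathrm{o}(1).$$ Then, for every $f\in B[0,1]\cap C(0,1)$, $$\lim_{n\to\infty}\|\alpha_n\, G_n(\psi f)-2F(f)\|_{\psi}=0 .$$
   Context: $C[0,1]$ is the space of continuous functions $[0,1]\to\mathbb{R}$; $B[0,1]$ is the space of bounded functions $[0,1]\to\mathbb{R}$; $C(0,1)$ denotes the set of functions $f:[0,1]\to\mathbb{R}$ that are continuous on $(0,1)$. $e_j(t)=t^j$ on $[0,1]$, and $\psi(x)=x(1-x)$, $x\in[0,1]$. $C_\psi[0,1]=\{f:[0,1]\to\mathbb{R}\mid \exists g\in B[0,1]\cap C(0,1):\ f=\psi g\}$ (equivalently, the $f\in C[0,1]$ for which there is $M>0$ with $|f|\le M\psi$), with norm $\|f\|_\psi=\sup_{x\in(0,1)}|f(x)|/\psi(x)$. $B_1(f)(x)=(1-x)f(0)+xf(1)$ is the Bernstein operator of order one. $\Lambda$ is the class of all positive linear operators $L:C[0,1]\to C[0,1]$ such that (a) $L$ preserves linear functions ($L e_0=e_0$, $Le_1=e_1$);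 (b) $\|L(\psi)\|_\psi<1$; (c) $L\neq B_1$. For $L\in\Lambda$, $b_L:[0,1]\to\mathbb{R}$ is given by $b_L(x)=L(\psi)(x)/\psi(x)$ for $x\in(0,1)$ and $b_L(x)=\|L(\psi)\|_\psi$ for $x\in\{0,1\}$. For $L\in\Lambda$ the geometric series is $G_L:C_\psi[0,1]\to C_\psi[0,1]$, $G_L(f)=\sum_{k=0}^\infty L^k(f)$, with convergence in $\|\cdot\|_\psi$, where $L^0=I$ and $L^k$ is the $k$-th iterate; the series converges for every $f\in C_\psi[0,1]$. For the sequence $(L_n)$: $G_n=G_{L_n}$, $\alpha_n=1-b_{L_n}$, $\nu_n=\min_{x\in[0,1]}\alpha_n(x)$, $\eta_n=\sup_{x,y\in[0,1]}|\alpha_n(x)-\alpha_n(y)|/\nu_n$, and $M_n^k(x)=L_n((e_1-xe_0)^k)(x)$ for $x\in[0,1]$, $k\in\mathbb{N}\cup\{0\}$ (the superscript is an index; $M_n^2=\alpha_n\psi$). For $f\in B[0,1]\cap C(0,1)$ and $x\in[0,1]$: $F(f)(x)=(1-x)\int_0^x t f(t)\,dt+x\int_x^1(1-t)f(t)\,dt$. *)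

theory Defs
  imports "HOL-Analysis.Analysis" "HOL-Library.Landau_Symbols" "HOL-Library.FuncSet"
begin

text \<open>Functions on $[0,1]$ are rendered as functions on the reals of which only the values on
  $[0,1]$ matter; equality of functions (and of operators) is always equality on $[0,1]$.\<close>

definition C01 :: "(real \<Rightarrow> real) set" where
  "C01 = {f. continuous_on {0..1} f}"

definition B01 :: "(real \<Rightarrow> real) set" where
  "B01 = {f. bounded (f ` {0..1})}"

definition Copen :: "(real \<Rightarrow> real) set" where
  "Copen = {f. continuous_on {0<..<1} f}"

definition mono_fun :: "nat \<Rightarrow> real \<Rightarrow> real" where
  "mono_fun j = (\<lambda>t. t ^ j)"

definition psi :: "real \<Rightarrow> real" where
  "psi x = x * (1 - x)"

definition Cpsi :: "(real \<Rightarrow> real) set" where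
  "Cpsi = {f. \<exists>g \<in> B01 \<inter> Copen. \<forall>x\<in>{0..1}. f x = psi x * g x}"

text \<open>The supremum is meaningful when $|f|/\psi$ is bounded on $(0,1)$, in particular
  on \<^const>\<open>Cpsi\<close>.\<close>

definition psi_norm :: "(real \<Rightarrow> real) \<Rightarrow> real" where
  "psi_norm f = (SUP x\<in>{0<..<1}. \<bar>f x\<bar> / psi x)"

definition positive_linear_op :: "((real \<Rightarrow> real) \<Rightarrow> (real \<Rightarrow> real)) \<Rightarrow> bool" where
  "positive_linear_op L \<longleftrightarrow>
     (\<forall>f\<in>C01. L f \<in> C01) \<and>
     (\<forall>f\<in>C01. \<forall>g\<in>C01. \<forall>x\<in>{0..1}. L (\<lambda>t. f t + g t) x = L f x + L g x) \<and>
     (\<forall>f\<in>C01. \<forall>c. \<forall>x\<in>{0..1}. L (\<lambda>t. c * f t) x = c * L f x) \<and>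
     (\<forall>f\<in>C01. (\<forall>t\<in>{0..1}. 0 \<le> f t) \<longrightarrow> (\<forall>x\<in>{0..1}. 0 \<le> L f x))"

text \<open>Such an operator automatically depends only on the values on $[0,1]$, so that it
  induces an operator on $C[0,1]$ proper.\<close>

lemma positive_linear_op_cong:
  assumes L: "positive_linear_op L" and f: "f \<in> C01" and g: "g \<in> C01"
    and eq: "\<And>t. t \<in> {0..1} \<Longrightarrow> f t = g t" and x: "x \<in> {0..1}"
  shows "L f x = L g x"
proof -
  have le: "L u x \<le> L v x" if u: "u \<in> C01" and v: "v \<in> C01"
    and uv: "\<And>t. t \<in> {0..1} \<Longrightarrow> u t = v t" for u v
  proof -
    let ?d = "\<lambda>t. v t - u t"
    have d: "?d \<in> C01"
      using u v unfolding C01_def by (auto intro: continuous_on_diff)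
    have add: "\<forall>w\<in>C01. \<forall>w'\<in>C01. \<forall>y\<in>{0..1}. L (\<lambda>t. w t + w' t) y = L w y + L w' y"
      using L unfolding positive_linear_op_def by simp
    have "0 \<le> L ?d x"
      using L d uv x unfolding positive_linear_op_def by simp
    moreover have "L (\<lambda>t. u t + ?d t) x = L u x + L ?d x"
      by (rule add[THEN bspec, OF u, THEN bspec, OF d, THEN bspec, OF x])
    ultimately show ?thesis by simp
  qed
  show ?thesis using le[OF f g] le[OF g f] eq by (simp add: antisym)
qed

definition bernstein1 :: "(real \<Rightarrow> real) \<Rightarrow> real \<Rightarrow> real" where
  "bernstein1 f x = (1 - x) * f 0 + x * f 1"

definition Lambda :: "((real \<Rightarrow> real) \<Rightarrow> (real \<Rightarrow> real)) set" where
  "Lambda = {L. positive_linear_op L \<and>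
     (\<forall>x\<in>{0..1}. L (mono_fun 0) x = mono_fun 0 x) \<and>
     (\<forall>x\<in>{0..1}. L (mono_fun 1) x = mono_fun 1 x) \<and>
     psi_norm (L psi) < 1 \<and>
     \<not> (\<forall>f\<in>C01. \<forall>x\<in>{0..1}. L f x = bernstein1 f x)}"

definition b_fun :: "((real \<Rightarrow> real) \<Rightarrow> (real \<Rightarrow> real)) \<Rightarrow> real \<Rightarrow> real" where
  "b_fun L x = (if x \<in> {0<..<1} then L psi x / psi x else psi_norm (L psi))"

definition alpha :: "((real \<Rightarrow> real) \<Rightarrow> (real \<Rightarrow> real)) \<Rightarrow> real \<Rightarrow> real" where
  "alpha L x = 1 - b_fun L x"

definition nu :: "((real \<Rightarrow> real) \<Rightarrow> (real \<Rightarrow> real)) \<Rightarrow> real" where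
  "nu L = (LEAST y. y \<in> alpha L ` {0..1})"

definition eta :: "((real \<Rightarrow> real) \<Rightarrow> (real \<Rightarrow> real)) \<Rightarrow> real" where
  "eta L = (SUP (x, y)\<in>{0..1} \<times> {0..1}. \<bar>alpha L x - alpha L y\<bar> / nu L)"

definition moment :: "((real \<Rightarrow> real) \<Rightarrow> (real \<Rightarrow> real)) \<Rightarrow> nat \<Rightarrow> real \<Rightarrow> real" where
  "moment L k x = L (\<lambda>t. (mono_fun 1 t - x * mono_fun 0 t) ^ k) x"

text \<open>The sum of the series with respect to \<^const>\<open>psi_norm\<close>. That norm only determines the
  values on $[0,1]$; membership in \<^const>\<open>extensional\<close> makes the limit unique.\<close>

definition geom_series :: "((real \<Rightarrow> real) \<Rightarrow> (real \<Rightarrow> real)) \<Rightarrow> (real \<Rightarrow> real) \<Rightarrow> real \<Rightarrow> real" where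
  "geom_series L f = (THE h. h \<in> Cpsi \<and> h \<in> extensional {0..1} \<and>
     (\<lambda>n. psi_norm (\<lambda>x. (\<Sum>k<n. (L ^^ k) f x) - h x)) \<longlonglongrightarrow> 0)"

definition F_op :: "(real \<Rightarrow> real) \<Rightarrow> real \<Rightarrow> real" where
  "F_op f x = (1 - x) * integral {0..x} (\<lambda>t. t * f t)
            + x * integral {x..1} (\<lambda>t. (1 - t) * f t)"

end

theory Submission
  imports Defs
begin

text \<open>The series \<open>h = G_L(\<psi>f)\<close> is the solution in \<open>C_\<psi>\<close> of \<open>h - Lh = \<psi>f\<close>, and \<open>I - L\<close> satisfies
  a maximum principle on \<open>C_\<psi>\<close> because \<open>\<parallel>L\<psi>\<parallel>_\<psi> < 1\<close>. Since \<open>(Ff)'' = -f\<close>, a Voronovskaja estimate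
  gives \<open>(I - L_n)(2Ff) \<approx> M_n^2 f = \<alpha>_n\<psi>f\<close> with an error that is a small multiple of
  \<open>\<alpha>_n\<psi> = (I - L_n)\<psi>\<close>. For a fixed point \<open>x\<close>, applying the maximum principle to
  \<open>\<alpha>_n(x) h - 2Ff\<close> (with the constant \<open>\<alpha>_n(x)\<close>; replacing it by the function \<open>\<alpha>_n\<close> costs only
  \<open>\<eta>_n\<nu>_n \<le> \<eta>_n\<alpha>_n\<close>) and evaluating at \<open>x\<close> proves the claim for \<open>f\<close> continuous on \<open>[0,1]\<close>.
  A general \<open>f\<close> is multiplied by \<open>1 - (1 - 2t)^{2m}\<close>, which makes it continuous on \<open>[0,1]\<close>; the
  part cut off is controlled by the continuous case for \<open>(1 - 2t)^{2m}\<close>, whose integral is small.\<close>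

section \<open>The weight \<open>psi\<close> and the space \<open>Cpsi\<close>\<close>

lemma psi_nonneg: "x \<in> {0..1} \<Longrightarrow> 0 \<le> psi x"
  by (simp add: psi_def)

lemma psi_pos: "x \<in> {0<..<1} \<Longrightarrow> 0 < psi x"
  by (simp add: psi_def)

lemma psi_endpoint: "x \<in> {0..1} \<Longrightarrow> x \<notin> {0<..<1} \<Longrightarrow> psi x = 0"
  by (auto simp: psi_def)

lemma continuous_on_psi [continuous_intros]: "continuous_on S psi"
  unfolding psi_def by (intro continuous_intros)

lemma B01_iff: "f \<in> B01 \<longleftrightarrow> (\<exists>K. \<forall>x\<in>{0..1}. \<bar>f x\<bar> \<le> K)"
  by (simp add: B01_def bounded_iff)

text \<open>At an endpoint \<open>w\<close> vanishes, so \<open>h\<close> vanishes there too and is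
  squeezed to 0. This is how continuity reaches the closed interval, both for the members of
  \<open>Cpsi\<close> and for the cut-off function in the final proof.\<close>

lemma continuous_on_Icc_by_majorant:
  fixes h w :: "real \<Rightarrow> real"
  assumes h: "continuous_on {0<..<1} h" and w: "continuous_on {0..1} w"
    and le: "\<And>x. x \<in> {0..1} \<Longrightarrow> \<bar>h x\<bar> \<le> w x"
    and w0: "w 0 = 0" "w 1 = 0"
  shows "continuous_on {0..1} h"
proof -
  have "(h \<longlongrightarrow> h x) (at x within {0..1})" if x: "x \<in> {0..1}" for x
  proof (cases "x \<in> {0<..<1}")
    case True
    then have "(h \<longlongrightarrow> h x) (at x)"
      using h by (metis continuous_on_eq_continuous_at isCont_def open_greaterThanLessThan)
    then show ?thesis by (rule tendsto_within_subset) simp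
  next
    case False
    with x have wx: "w x = 0" using w0 by auto
    then have hx: "h x = 0" using le[OF x] by simp
    have "(w \<longlongrightarrow> 0) (at x within {0..1})"
      using w x wx by (metis continuous_on_def)
    moreover have "\<forall>\<^sub>F y in at x within {0..1}. norm (h y) \<le> w y"
      using le by (auto simp: eventually_at_filter)
    ultimately show ?thesis unfolding hx by (rule Lim_null_comparison[rotated])
  qed
  then show ?thesis by (simp add: continuous_on_def)
qed

text \<open>Trades the factorisation through \<open>g\<close> for continuity plus a bound, which is
  easier to check and to use. Continuity at the endpoints comes from the majorant
  \<open>K * psi\<close>.\<close>

lemma Cpsi_iff:
  "h \<in> Cpsi \<longleftrightarrow> continuous_on {0..1} h \<and> (\<exists>K. \<forall>x\<in>{0..1}. \<bar>h x\<bar> \<le> K * psi x)"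
proof
  assume "h \<in> Cpsi"
  then obtain g where g: "g \<in> B01" "g \<in> Copen" and hg: "\<And>x. x \<in> {0..1} \<Longrightarrow> h x = psi x * g x"
    unfolding Cpsi_def by blast
  from g(1) obtain K where K: "\<And>x. x \<in> {0..1} \<Longrightarrow> \<bar>g x\<bar> \<le> K"
    unfolding B01_iff by blast
  have le: "\<bar>h x\<bar> \<le> K * psi x" if "x \<in> {0..1}" for x
    using mult_left_mono[OF K[OF that] psi_nonneg[OF that]] psi_nonneg[OF that]
    by (simp add: hg[OF that] abs_mult mult.commute)
  have "continuous_on {0<..<1} (\<lambda>x. psi x * g x)"
    using g(2) unfolding Copen_def by (auto intro!: continuous_intros)
  then have "continuous_on {0<..<1} h"
    by (rule continuous_on_cong[THEN iffD1, rotated -1]) (auto simp: hg)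
  then have "continuous_on {0..1} h"
    by (rule continuous_on_Icc_by_majorant[where w = "\<lambda>x. K * psi x"])
       (auto intro!: continuous_intros le simp: psi_def[of 0] psi_def[of 1])
  with le show "continuous_on {0..1} h \<and> (\<exists>K. \<forall>x\<in>{0..1}. \<bar>h x\<bar> \<le> K * psi x)" by blast
next
  assume "continuous_on {0..1} h \<and> (\<exists>K. \<forall>x\<in>{0..1}. \<bar>h x\<bar> \<le> K * psi x)"
  then obtain K where h: "continuous_on {0..1} h" and K: "\<And>x. x \<in> {0..1} \<Longrightarrow> \<bar>h x\<bar> \<le> K * psi x"
    by blast
  \<comment> \<open>At the endpoints division by zero makes \<open>?g\<close> equal to 0, so it is
    bounded on the closed interval; \<open>h\<close> vanishes there as well, so
    \<open>h = psi * ?g\<close> survives.\<close>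
  let ?g = "\<lambda>x. h x / psi x"
  have "\<bar>?g x\<bar> \<le> \<bar>K\<bar>" if x: "x \<in> {0..1}" for x
  proof (cases "x \<in> {0<..<1}")
    case True
    then have "\<bar>?g x\<bar> \<le> K" using K[OF x] psi_pos[OF True] by (simp add: field_simps)
    then show ?thesis by linarith
  next
    case False
    then show ?thesis using psi_endpoint[OF x] by simp
  qed
  then have "?g \<in> B01" unfolding B01_def bounded_iff by (auto intro!: exI[of _ "\<bar>K\<bar>"])
  moreover have "?g \<in> Copen"
    unfolding Copen_def mem_Collect_eq
  proof (intro continuous_on_divide continuous_on_psi)
    show "continuous_on {0<..<1} h" by (rule continuous_on_subset[OF h]) auto
    show "\<forall>x\<in>{0<..<1}. psi x \<noteq> 0" using psi_pos by force
  qed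
  moreover have "h x = psi x * ?g x" if x: "x \<in> {0..1}" for x
  proof (cases "x \<in> {0<..<1}")
    case True
    then show ?thesis using psi_pos[OF True] by simp
  next
    case False
    then show ?thesis using psi_endpoint[OF x] K[OF x] by simp
  qed
  ultimately show "h \<in> Cpsi" unfolding Cpsi_def by (intro CollectI bexI[of _ ?g]) simp_all
qed

lemma Cpsi_imp_C01: "h \<in> Cpsi \<Longrightarrow> h \<in> C01"
  by (simp add: Cpsi_iff C01_def)

lemma CpsiI:
  assumes "continuous_on {0..1} h" "\<And>x. x \<in> {0..1} \<Longrightarrow> \<bar>h x\<bar> \<le> K * psi x"
  shows "h \<in> Cpsi"
  unfolding Cpsi_iff using assms by blast

lemma Cpsi_cmult: "h \<in> Cpsi \<Longrightarrow> (\<lambda>x. c * h x) \<in> Cpsi"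
proof -
  assume h: "h \<in> Cpsi"
  then obtain K where "continuous_on {0..1} h" and K: "\<And>x. x \<in> {0..1} \<Longrightarrow> \<bar>h x\<bar> \<le> K * psi x"
    unfolding Cpsi_iff by blast
  then show ?thesis
    by (intro CpsiI[where K = "\<bar>c\<bar> * K"])
       (auto intro!: continuous_intros mult_left_mono simp: abs_mult mult.assoc)
qed

lemma Cpsi_diff: "h \<in> Cpsi \<Longrightarrow> g \<in> Cpsi \<Longrightarrow> (\<lambda>x. h x - g x) \<in> Cpsi"
proof -
  assume h: "h \<in> Cpsi" "g \<in> Cpsi"
  then obtain K J where "continuous_on {0..1} h" "continuous_on {0..1} g"
    and K: "\<And>x. x \<in> {0..1} \<Longrightarrow> \<bar>h x\<bar> \<le> K * psi x"
    and J: "\<And>x. x \<in> {0..1} \<Longrightarrow> \<bar>g x\<bar> \<le> J * psi x"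
    unfolding Cpsi_iff by blast
  then show ?thesis
    by (intro CpsiI[where K = "K + J"])
       (auto intro!: continuous_intros order_trans[OF abs_triangle_ineq4] add_mono simp: distrib_right)
qed

lemma Cpsi_psi: "psi \<in> Cpsi"
  by (rule CpsiI[where K = 1]) (auto intro: continuous_intros simp: psi_nonneg)

lemma Cpsi_psi_mult:
  assumes "f \<in> B01 \<inter> Copen"
  shows "(\<lambda>t. psi t * f t) \<in> Cpsi"
  using assms unfolding Cpsi_def by blast

section \<open>The weighted norm\<close>

lemma psi_norm_le:
  assumes "\<And>x. x \<in> {0<..<1} \<Longrightarrow> \<bar>w x\<bar> \<le> c * psi x"
  shows "psi_norm w \<le> c" and "0 \<le> psi_norm w"
proof -
  have le: "\<bar>w x\<bar> / psi x \<le> c" if "x \<in> {0<..<1}" for x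
    using assms[OF that] psi_pos[OF that] by (simp add: field_simps)
  show "psi_norm w \<le> c"
    unfolding psi_norm_def using le by (intro cSUP_least) auto
  have "bdd_above ((\<lambda>x. \<bar>w x\<bar> / psi x) ` {0<..<1})"
    using le by (rule bdd_aboveI2)
  then show "0 \<le> psi_norm w"
    unfolding psi_norm_def by (rule cSUP_upper2[where x = "1/2"]) (auto simp: psi_def)
qed

text \<open>The constant \<open>c\<close> makes the set of quotients bounded above, so that the real
  supremum really dominates them; at the endpoints it forces \<open>w\<close> to vanish.\<close>

lemma abs_le_psi_norm:
  assumes "\<And>x. x \<in> {0..1} \<Longrightarrow> \<bar>w x\<bar> \<le> c * psi x" and x: "x \<in> {0..1}"
  shows "\<bar>w x\<bar> \<le> psi_norm w * psi x"
proof (cases "x \<in> {0<..<1}")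
  case True
  have le: "\<bar>w x\<bar> / psi x \<le> c" if "x \<in> {0<..<1}" for x
    using assms(1)[of x] that psi_pos[OF that] by (simp add: field_simps)
  have "bdd_above ((\<lambda>x. \<bar>w x\<bar> / psi x) ` {0<..<1})"
    using le by (rule bdd_aboveI2)
  then have "\<bar>w x\<bar> / psi x \<le> psi_norm w"
    unfolding psi_norm_def by (rule cSUP_upper2[where x = x]) (use True in auto)
  then show ?thesis using psi_pos[OF True] by (simp add: field_simps)
next
  case False
  then show ?thesis using assms(1)[OF x] psi_endpoint[OF x] by simp
qed

section \<open>Positive linear operators and the class \<open>Lambda\<close>\<close>

lemma plo_C01: "positive_linear_op L \<Longrightarrow> u \<in> C01 \<Longrightarrow> L u \<in> C01"
  by (simp add: positive_linear_op_def)

lemma plo_add: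
  "positive_linear_op L \<Longrightarrow> u \<in> C01 \<Longrightarrow> v \<in> C01 \<Longrightarrow> x \<in> {0..1} \<Longrightarrow>
    L (\<lambda>t. u t + v t) x = L u x + L v x"
  unfolding positive_linear_op_def by blast

lemma plo_cmult:
  "positive_linear_op L \<Longrightarrow> u \<in> C01 \<Longrightarrow> x \<in> {0..1} \<Longrightarrow> L (\<lambda>t. c * u t) x = c * L u x"
  unfolding positive_linear_op_def by blast

lemma plo_diff:
  assumes L: "positive_linear_op L" and u: "u \<in> C01" and v: "v \<in> C01" and x: "x \<in> {0..1}"
  shows "L (\<lambda>t. u t - v t) x = L u x - L v x"
proof -
  have "(\<lambda>t. - 1 * v t) \<in> C01"
    using v unfolding C01_def by (auto intro!: continuous_intros)
  then have "L (\<lambda>t. u t + - 1 * v t) x = L u x + - 1 * L v x"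
    by (subst plo_add[OF L u _ x]) (auto simp only: plo_cmult[OF L v x])
  then show ?thesis by simp
qed

lemma plo_mono:
  assumes L: "positive_linear_op L" and u: "u \<in> C01" and v: "v \<in> C01" and x: "x \<in> {0..1}"
    and le: "\<And>t. t \<in> {0..1} \<Longrightarrow> u t \<le> v t"
  shows "L u x \<le> L v x"
proof -
  have "(\<lambda>t. v t - u t) \<in> C01"
    using u v unfolding C01_def by (auto intro!: continuous_intros)
  then have "0 \<le> L (\<lambda>t. v t - u t) x"
    using L le x unfolding positive_linear_op_def by simp
  then show ?thesis using plo_diff[OF L v u x] by simp
qed

lemma plo_abs_le:
  assumes L: "positive_linear_op L" and u: "u \<in> C01" and v: "v \<in> C01" and x: "x \<in> {0..1}"
    and le: "\<And>t. t \<in> {0..1} \<Longrightarrow> \<bar>u t\<bar> \<le> v t"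
  shows "\<bar>L u x\<bar> \<le> L v x"
proof -
  have v': "(\<lambda>t. - 1 * v t) \<in> C01"
    using v unfolding C01_def by (auto intro!: continuous_intros)
  have "L (\<lambda>t. - 1 * v t) x \<le> L u x"
    by (rule plo_mono[OF L v' u x]) (use le in \<open>auto simp: abs_le_iff minus_le_iff\<close>)
  moreover have "L u x \<le> L v x"
    by (rule plo_mono[OF L u v x]) (use le in \<open>auto simp: abs_le_iff\<close>)
  ultimately show ?thesis using plo_cmult[OF L v x, of "-1"] by simp
qed

lemma C01_psi: "psi \<in> C01"
  by (simp add: C01_def continuous_on_psi)

lemma Lambda_plo: "L \<in> Lambda \<Longrightarrow> positive_linear_op L"
  by (simp add: Lambda_def)

lemma Lambda_affine:
  assumes L: "L \<in> Lambda" and x: "x \<in> {0..1}"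
  shows "L (\<lambda>t. a + c * t) x = a + c * x"
proof -
  have e: "(\<lambda>t. a * mono_fun 0 t) \<in> C01" "(\<lambda>t. c * mono_fun 1 t) \<in> C01"
      "mono_fun 0 \<in> C01" "mono_fun 1 \<in> C01"
    by (auto simp: C01_def mono_fun_def intro!: continuous_intros)
  have "L (\<lambda>t. a * mono_fun 0 t + c * mono_fun 1 t) x = a * mono_fun 0 x + c * mono_fun 1 x"
    using L x plo_add[OF Lambda_plo[OF L] e(1,2) x] plo_cmult[OF Lambda_plo[OF L] _ x] e
    by (simp add: Lambda_def)
  then show ?thesis by (simp add: mono_fun_def)
qed

text \<open>\<open>(t - x)^2\<close> is an affine function of \<open>t\<close> minus
  \<open>psi t\<close>, and \<open>L\<close> preserves affine functions.\<close>

lemma Lambda_moment2: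
  assumes L: "L \<in> Lambda" and x: "x \<in> {0..1}"
  shows "moment L 2 x = psi x - L psi x"
proof -
  have c: "(\<lambda>t. x\<^sup>2 + (1 - 2 * x) * t) \<in> C01"
    by (auto simp: C01_def intro!: continuous_intros)
  have "(\<lambda>t. (mono_fun 1 t - x * mono_fun 0 t) ^ 2) = (\<lambda>t. (x\<^sup>2 + (1 - 2 * x) * t) - psi t)"
    by (auto simp: mono_fun_def psi_def power2_eq_square algebra_simps)
  then have "moment L 2 x = L (\<lambda>t. (x\<^sup>2 + (1 - 2 * x) * t) - psi t) x"
    by (simp add: moment_def)
  also have "\<dots> = x\<^sup>2 + (1 - 2 * x) * x - L psi x"
    using plo_diff[OF Lambda_plo[OF L] c C01_psi x] Lambda_affine[OF L x] by simp
  finally show ?thesis by (simp add: psi_def power2_eq_square algebra_simps)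
qed

text \<open>The upper bound is the nonnegativity of the second moment.\<close>

lemma Lambda_psi_bounds:
  assumes L: "L \<in> Lambda" and x: "x \<in> {0..1}"
  shows "0 \<le> L psi x" and "L psi x \<le> psi x"
proof -
  show "0 \<le> L psi x"
    using Lambda_plo[OF L] C01_psi psi_nonneg x unfolding positive_linear_op_def by blast
  have "(\<lambda>t. (mono_fun 1 t - x * mono_fun 0 t) ^ 2) \<in> C01"
    by (auto simp: C01_def mono_fun_def intro!: continuous_intros)
  then have "0 \<le> moment L 2 x"
    using Lambda_plo[OF L] x unfolding moment_def positive_linear_op_def by simp
  then show "L psi x \<le> psi x" using Lambda_moment2[OF L x] by simp
qed

lemma Lambda_psi_norm:
  assumes L: "L \<in> Lambda"
  shows "0 \<le> psi_norm (L psi)" "psi_norm (L psi) < 1"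
    and "x \<in> {0..1} \<Longrightarrow> L psi x \<le> psi_norm (L psi) * psi x"
proof -
  have le: "\<bar>L psi x\<bar> \<le> 1 * psi x" if "x \<in> {0..1}" for x
    using Lambda_psi_bounds[OF L that] by simp
  show "0 \<le> psi_norm (L psi)" by (rule psi_norm_le(2)[where c = 1]) (use le in auto)
  show "psi_norm (L psi) < 1" using L by (simp add: Lambda_def)
  show "L psi x \<le> psi_norm (L psi) * psi x" if "x \<in> {0..1}"
    using abs_le_psi_norm[OF le that] by simp
qed

text \<open>\<open>L\<close> contracts the weighted norm by the factor
  \<open>psi_norm (L psi)\<close>: by positivity the majorant \<open>K * psi\<close> may be pushed
  through \<open>L\<close>.\<close>

lemma Lambda_abs_le:
  assumes L: "L \<in> Lambda" and u: "u \<in> C01" and x: "x \<in> {0..1}"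
    and le: "\<And>t. t \<in> {0..1} \<Longrightarrow> \<bar>u t\<bar> \<le> K * psi t" and K: "0 \<le> K"
  shows "\<bar>L u x\<bar> \<le> K * psi_norm (L psi) * psi x"
proof -
  have "(\<lambda>t. K * psi t) \<in> C01" by (auto simp: C01_def intro!: continuous_intros)
  then have "\<bar>L u x\<bar> \<le> K * L psi x"
    using plo_abs_le[OF Lambda_plo[OF L] u _ x le] plo_cmult[OF Lambda_plo[OF L] C01_psi x] by simp
  also have "\<dots> \<le> K * (psi_norm (L psi) * psi x)"
    by (intro mult_left_mono Lambda_psi_norm[OF L] x K)
  finally show ?thesis by (simp add: mult.assoc)
qed

section \<open>The maximum principle for \<open>I - L\<close>\<close>

text \<open>Let \<open>s\<close> be the supremum of \<open>v / psi\<close> and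
  \<open>q = psi_norm (L psi) < 1\<close>. If \<open>s > 0\<close>, then
  \<open>v \<le> L v \<le> s * L psi \<le> s * q * psi\<close>, hence
  \<open>s \<le> s * q < s\<close>, which is absurd.\<close>

lemma Lambda_comparison:
  assumes L: "L \<in> Lambda" and v: "v \<in> Cpsi"
    and le: "\<And>x. x \<in> {0..1} \<Longrightarrow> v x \<le> L v x" and x: "x \<in> {0..1}"
  shows "v x \<le> 0"
proof -
  obtain K where K: "\<And>x. x \<in> {0..1} \<Longrightarrow> \<bar>v x\<bar> \<le> K * psi x"
    using v unfolding Cpsi_iff by blast
  let ?A = "(\<lambda>x. v x / psi x) ` {0<..<1}"
  define s where "s = Sup ?A"
  let ?q = "psi_norm (L psi)"
  have "v x / psi x \<le> K" if "x \<in> {0<..<1}" for x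
    using K[of x] that psi_pos[OF that] by (simp add: field_simps)
  then have bdd: "bdd_above ?A" by (rule bdd_aboveI2)
  have le_s: "v x \<le> s * psi x" if x: "x \<in> {0..1}" for x
  proof (cases "x \<in> {0<..<1}")
    case True
    then have "v x / psi x \<le> s" unfolding s_def using bdd by (intro cSup_upper) auto
    then show ?thesis using psi_pos[OF True] by (simp add: field_simps)
  next
    case False
    then show ?thesis using K[OF x] psi_endpoint[OF x] by simp
  qed
  have "s \<le> 0"
  proof (rule ccontr)
    assume s: "\<not> s \<le> 0"
    have c: "(\<lambda>t. s * psi t) \<in> C01" by (auto simp: C01_def intro!: continuous_intros)
    have "v x \<le> s * ?q * psi x" if x: "x \<in> {0..1}" for x
    proof -
      have "v x \<le> L v x" by (rule le[OF x])
      also have "\<dots> \<le> s * L psi x"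
        using plo_mono[OF Lambda_plo[OF L] Cpsi_imp_C01[OF v] c x le_s]
          plo_cmult[OF Lambda_plo[OF L] C01_psi x] by simp
      also have "\<dots> \<le> s * (?q * psi x)"
        using s by (intro mult_left_mono Lambda_psi_norm[OF L] x) auto
      finally show ?thesis by (simp add: mult.assoc)
    qed
    then have "v x / psi x \<le> s * ?q" if "x \<in> {0<..<1}" for x
      using that psi_pos[OF that] by (simp add: field_simps)
    then have "s \<le> s * ?q" unfolding s_def by (intro cSup_least) auto
    then show False using s Lambda_psi_norm(2)[OF L] by simp
  qed
  then have "s * psi x \<le> 0" using psi_nonneg[OF x] by (simp add: mult_nonpos_nonneg)
  then show ?thesis using le_s[OF x] by linarith
qed

text \<open>The maximum principle is applied to \<open>v - w\<close> and to \<open>- v - w\<close>.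
  All later pointwise bounds on the geometric series come from this form.\<close>

lemma Lambda_comparison_abs:
  assumes L: "L \<in> Lambda" and v: "v \<in> Cpsi" and w: "w \<in> Cpsi"
    and le: "\<And>x. x \<in> {0..1} \<Longrightarrow> \<bar>v x - L v x\<bar> \<le> w x - L w x" and x: "x \<in> {0..1}"
  shows "\<bar>v x\<bar> \<le> w x"
proof -
  note P = Lambda_plo[OF L]
  have C: "v \<in> C01" "w \<in> C01" "(\<lambda>t. - 1 * v t) \<in> C01"
    using v w Cpsi_imp_C01 Cpsi_cmult by blast+
  have "v x - w x \<le> 0"
    by (rule Lambda_comparison[OF L Cpsi_diff[OF v w] _ x])
       (use le plo_diff[OF P C(1,2)] in \<open>force simp: abs_le_iff\<close>)
  moreover have "- 1 * v x - w x \<le> 0"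
    by (rule Lambda_comparison[OF L Cpsi_diff[OF Cpsi_cmult[OF v] w] _ x])
       (use le plo_diff[OF P C(3,2)] plo_cmult[OF P C(1), of _ "-1"] in \<open>force simp: abs_le_iff\<close>)
  ultimately show ?thesis by (simp add: abs_le_iff)
qed

section \<open>The geometric series as solution of \<open>h - L h = g\<close>\<close>

text \<open>The iterates decay like \<open>q^k\<close> relative to \<open>psi\<close>, so the
  pointwise sum \<open>h\<close> has geometric tails. This puts \<open>h\<close> in
  \<open>Cpsi\<close>, makes it the limit in the weighted norm, and lets the identity
  \<open>L (S n) = S (Suc n) - g\<close> pass to the limit. The definite description then has to be
  shown to pick \<open>h\<close>.\<close>

lemma geom_series_solves:
  assumes L: "L \<in> Lambda" and g: "g \<in> Cpsi"
  shows "geom_series L g \<in> Cpsi"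
    and "x \<in> {0..1} \<Longrightarrow> geom_series L g x - L (geom_series L g) x = g x"
proof -
  note P = Lambda_plo[OF L]
  let ?q = "psi_norm (L psi)"
  have q: "0 \<le> ?q" "?q < 1" using Lambda_psi_norm[OF L] by auto
  obtain K0 where K0: "\<And>x. x \<in> {0..1} \<Longrightarrow> \<bar>g x\<bar> \<le> K0 * psi x"
    using g unfolding Cpsi_iff by blast
  define K where "K = \<bar>K0\<bar>"
  have K: "\<bar>g x\<bar> \<le> K * psi x" if "x \<in> {0..1}" for x
    using K0[OF that] mult_right_mono[OF abs_ge_self psi_nonneg[OF that], of K0]
    unfolding K_def by linarith
  have K_nonneg: "0 \<le> K" by (simp add: K_def)
  have gk: "(L ^^ k) g \<in> C01 \<and> (\<forall>x\<in>{0..1}. \<bar>(L ^^ k) g x\<bar> \<le> K * ?q ^ k * psi x)" for k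
  proof (induction k)
    case 0
    then show ?case using Cpsi_imp_C01[OF g] K by simp
  next
    case (Suc k)
    then have "\<bar>L ((L ^^ k) g) x\<bar> \<le> K * ?q ^ k * ?q * psi x" if "x \<in> {0..1}" for x
      using that K_nonneg q by (intro Lambda_abs_le[OF L]) auto
    then show ?case using Suc plo_C01[OF P] by (auto simp: mult_ac)
  qed
  define S where "S = (\<lambda>n x. \<Sum>k<n. (L ^^ k) g x)"
  \<comment> \<open>The value \<open>undefined\<close> outside the interval is what membership in
    \<open>extensional\<close> asks for.\<close>
  define h where "h = (\<lambda>x. if x \<in> {0..1} then \<Sum>k. (L ^^ k) g x else undefined)"
  define D where "D = K / (1 - ?q)"
  have D: "0 \<le> D" using q K_nonneg by (simp add: D_def)
  have S_C01: "S n \<in> C01" for n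
    using gk unfolding S_def C01_def by (auto intro!: continuous_on_sum)
  have tail: "\<bar>S n x - h x\<bar> \<le> D * ?q ^ n * psi x" if x: "x \<in> {0..1}" for n x
  proof -
    have geo: "(\<lambda>k. K * psi x * ?q ^ n * ?q ^ k) sums (K * psi x * ?q ^ n * (1 / (1 - ?q)))"
      using q by (intro sums_mult geometric_sums) simp
    have summ: "summable (\<lambda>k. (L ^^ k) g x)"
      by (rule summable_comparison_test'[where g = "\<lambda>k. K * psi x * ?q ^ k" and N = 0])
         (use gk x q in \<open>auto simp: mult_ac intro!: summable_mult summable_geometric\<close>)
    have bd: "norm ((L ^^ (k + n)) g x) \<le> K * psi x * ?q ^ n * ?q ^ k" for k
      using gk[of "k + n"] x by (auto simp: power_add mult_ac)
    have "h x - S n x = (\<Sum>k. (L ^^ (k + n)) g x)"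
      using suminf_split_initial_segment[OF summ, of n] x by (simp add: h_def S_def)
    moreover have "norm (\<Sum>k. (L ^^ (k + n)) g x) \<le> K * psi x * ?q ^ n * (1 / (1 - ?q))"
      using norm_suminf_le[OF bd sums_summable[OF geo]] sums_unique[OF geo] by simp
    ultimately show ?thesis by (simp add: D_def abs_minus_commute mult_ac)
  qed
  have S_h: "(\<lambda>n. S n x) \<longlonglongrightarrow> h x" if x: "x \<in> {0..1}" for x
  proof -
    have "(\<lambda>n. D * ?q ^ n * psi x) \<longlonglongrightarrow> 0"
      using q by (intro tendsto_mult_left_zero tendsto_mult_right_zero LIMSEQ_realpow_zero)
    then have "(\<lambda>n. S n x - h x) \<longlonglongrightarrow> 0"
      by (rule Lim_null_comparison[rotated]) (use tail[OF x] in auto)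
    then show ?thesis by (simp add: LIM_zero_iff)
  qed
  \<comment> \<open>Since \<open>psi \<le> 1\<close>, the weighted tail bound is a uniform one, and
    continuity of the partial sums carries over to \<open>h\<close>.\<close>
  have "uniform_limit {0..1} S h sequentially"
  proof (rule uniform_limitI)
    fix e :: real assume e: "0 < e"
    have "(\<lambda>n. D * ?q ^ n) \<longlonglongrightarrow> 0"
      using q by (intro tendsto_mult_right_zero LIMSEQ_realpow_zero)
    then have "\<forall>\<^sub>F n in sequentially. D * ?q ^ n < e"
      using e by (rule order_tendstoD)
    then show "\<forall>\<^sub>F n in sequentially. \<forall>x\<in>{0..1}. dist (S n x) (h x) < e"
    proof eventually_elim
      case (elim n)
      show ?case
      proof
        fix x :: real assume x: "x \<in> {0..1}"
        then have "psi x \<le> 1" unfolding psi_def by (auto intro: mult_le_one)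
        then have "D * ?q ^ n * psi x \<le> D * ?q ^ n"
          using D q by (simp add: mult_left_le)
        then show "dist (S n x) (h x) < e"
          using tail[OF x, of n] elim by (simp add: dist_real_def)
      qed
    qed
  qed
  then have "continuous_on {0..1} h"
    by (rule uniform_limit_theorem[rotated]) (use S_C01 in \<open>auto simp: C01_def\<close>)
  \<comment> \<open>\<open>S 0\<close> is the empty sum, so the tail bound at \<open>n = 0\<close>
    bounds \<open>h\<close> itself.\<close>
  moreover have "\<bar>h x\<bar> \<le> D * psi x" if "x \<in> {0..1}" for x
    using tail[OF that, of 0] by (simp add: S_def)
  ultimately have h: "h \<in> Cpsi" by (rule CpsiI)
  have h_eq: "h x - L h x = g x" if x: "x \<in> {0..1}" for x
  proof -
    have L_S: "L (S n) x = S (Suc n) x - g x" for n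
    proof -
      have "L (\<lambda>t. \<Sum>k<n. (L ^^ k) g t) x = (\<Sum>k<n. (L ^^ Suc k) g x)"
      proof (induction n)
        case 0
        \<comment> \<open>\<open>L\<close> maps the zero function to 0: homogeneity with the factor
          0.\<close>
        have "L (\<lambda>t. 0 * psi t) x = 0 * L psi x" by (rule plo_cmult[OF P C01_psi x])
        then show ?case by simp
      next
        case (Suc n)
        show ?case
          using plo_add[OF P S_C01[of n, unfolded S_def] conjunct1[OF gk[of n]] x] Suc
          by simp
      qed
      then show ?thesis unfolding S_def sum.lessThan_Suc_shift by simp
    qed
    have "(\<lambda>n. D * ?q ^ n * ?q * psi x) \<longlonglongrightarrow> 0"
      using q by (intro tendsto_mult_left_zero tendsto_mult_right_zero LIMSEQ_realpow_zero)
    moreover have "\<bar>L (S n) x - L h x\<bar> \<le> D * ?q ^ n * ?q * psi x" for n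
    proof -
      have "(\<lambda>t. S n t - h t) \<in> C01"
        using S_C01[of n] Cpsi_imp_C01[OF h] unfolding C01_def by (auto intro: continuous_intros)
      from Lambda_abs_le[OF L this x tail] D q show ?thesis
        by (simp add: plo_diff[OF P S_C01 Cpsi_imp_C01[OF h] x])
    qed
    ultimately have "(\<lambda>n. L (S n) x - L h x) \<longlonglongrightarrow> 0"
      by (elim Lim_null_comparison[rotated]) simp
    then have "(\<lambda>n. S (Suc n) x - g x) \<longlonglongrightarrow> L h x"
      by (simp add: L_S LIM_zero_iff)
    moreover have "(\<lambda>n. S (Suc n) x - g x) \<longlonglongrightarrow> h x - g x"
      by (intro tendsto_diff tendsto_const LIMSEQ_Suc S_h x)
    ultimately show ?thesis using LIMSEQ_unique by fastforce
  qed
  have "geom_series L g = h"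
    unfolding geom_series_def
  proof (rule the_equality)
    have "(\<lambda>n. psi_norm (\<lambda>x. S n x - h x)) \<longlonglongrightarrow> 0"
    proof (rule Lim_null_comparison)
      show "(\<lambda>n. D * ?q ^ n) \<longlonglongrightarrow> 0"
        using q by (intro tendsto_mult_right_zero LIMSEQ_realpow_zero)
      have "0 \<le> psi_norm (\<lambda>x. S n x - h x) \<and> psi_norm (\<lambda>x. S n x - h x) \<le> D * ?q ^ n" for n
        using psi_norm_le[of "\<lambda>x. S n x - h x" "D * ?q ^ n"] tail[of _ n] by simp
      then show "\<forall>\<^sub>F n in sequentially. norm (psi_norm (\<lambda>x. S n x - h x)) \<le> D * ?q ^ n"
        by simp
    qed
    moreover have "h \<in> extensional {0..1}" by (simp add: h_def extensional_def)
    ultimately show "h \<in> Cpsi \<and> h \<in> extensional {0..1} \<and>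
        (\<lambda>n. psi_norm (\<lambda>x. (\<Sum>k<n. (L ^^ k) g x) - h x)) \<longlonglongrightarrow> 0"
      using h by (simp add: S_def)
  next
    \<comment> \<open>Uniqueness: convergence in the weighted norm forces pointwise convergence on
      the interval, and extensionality settles all other points.\<close>
    fix h' assume h': "h' \<in> Cpsi \<and> h' \<in> extensional {0..1} \<and>
        (\<lambda>n. psi_norm (\<lambda>x. (\<Sum>k<n. (L ^^ k) g x) - h' x)) \<longlonglongrightarrow> 0"
    obtain K' where K': "\<And>x. x \<in> {0..1} \<Longrightarrow> \<bar>h x - h' x\<bar> \<le> K' * psi x"
      using Cpsi_diff[OF h, of h'] h' unfolding Cpsi_iff by blast
    \<comment> \<open>A bound by a multiple of \<open>psi\<close> has to be known before
      \<open>psi_norm\<close> controls values; the multiple may depend on \<open>n\<close>.\<close>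
    have bd: "\<bar>S n x - h' x\<bar> \<le> (D * ?q ^ n + K') * psi x" if x: "x \<in> {0..1}" for n x
      using tail[OF x, of n] K'[OF x] by (simp add: distrib_right)
    have "h' x = h x" if x: "x \<in> {0..1}" for x
    proof -
      have "(\<lambda>n. psi_norm (\<lambda>x. S n x - h' x) * psi x) \<longlonglongrightarrow> 0"
        using h' unfolding S_def by (intro tendsto_mult_left_zero) blast
      then have "(\<lambda>n. S n x - h' x) \<longlonglongrightarrow> 0"
        by (rule Lim_null_comparison[rotated]) (use abs_le_psi_norm[OF bd x] in auto)
      then have "(\<lambda>n. S n x) \<longlonglongrightarrow> h' x" by (simp add: LIM_zero_iff)
      then show ?thesis using S_h[OF x] LIMSEQ_unique by blast
    qed
    moreover have "h \<in> extensional {0..1}" by (simp add: h_def extensional_def)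
    ultimately show "h' = h" using h' by (intro extensionalityI) auto
  qed
  with h h_eq show "geom_series L g \<in> Cpsi"
    and "x \<in> {0..1} \<Longrightarrow> geom_series L g x - L (geom_series L g) x = g x" by auto
qed

section \<open>The quantities \<open>alpha\<close>, \<open>nu\<close> and \<open>eta\<close>\<close>

text \<open>With \<open>Lambda_moment2\<close> this says that the second moment is
  \<open>alpha L * psi\<close>. At the endpoints both sides vanish because \<open>L psi\<close> lies
  between 0 and \<open>psi\<close>.\<close>

lemma alpha_mult_psi:
  assumes L: "L \<in> Lambda" and x: "x \<in> {0..1}"
  shows "alpha L x * psi x = psi x - L psi x"
proof (cases "x \<in> {0<..<1}")
  case True
  then show ?thesis using psi_pos[OF True] by (simp add: alpha_def b_fun_def field_simps)
next
  case False
  then show ?thesis using psi_endpoint[OF x] Lambda_psi_bounds[OF L x] by simp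
qed

text \<open>The minimum is attained at the endpoint 0, where \<open>b_fun\<close> equals
  \<open>psi_norm (L psi)\<close> by definition. Hence the \<open>LEAST\<close> exists and
  \<open>nu L = 1 - psi_norm (L psi)\<close>.\<close>

lemma nu_bounds:
  assumes L: "L \<in> Lambda"
  shows "0 < nu L" and "x \<in> {0..1} \<Longrightarrow> nu L \<le> alpha L x" and "x \<in> {0..1} \<Longrightarrow> alpha L x \<le> 1"
proof -
  let ?q = "psi_norm (L psi)"
  have le: "1 - ?q \<le> alpha L x \<and> alpha L x \<le> 1" if x: "x \<in> {0..1}" for x
  proof (cases "x \<in> {0<..<1}")
    case True
    then show ?thesis using psi_pos[OF True] Lambda_psi_norm(3)[OF L x] Lambda_psi_bounds[OF L x]
      by (auto simp: alpha_def b_fun_def divide_le_eq)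
  next
    case False
    then show ?thesis using Lambda_psi_norm(1,2)[OF L] by (auto simp: alpha_def b_fun_def)
  qed
  have "alpha L 0 = 1 - ?q" by (simp add: alpha_def b_fun_def)
  then have "1 - ?q \<in> alpha L ` {0..1}" by (metis atLeastAtMost_iff imageI order_refl zero_le_one)
  then have nu: "nu L = 1 - ?q"
    unfolding nu_def by (rule Least_equality) (use le in auto)
  show "0 < nu L" using nu Lambda_psi_norm[OF L] by simp
  show "nu L \<le> alpha L x" "alpha L x \<le> 1" if "x \<in> {0..1}"
    using nu le[OF that] by auto
qed

text \<open>As \<open>alpha L\<close> takes values between 0 and 1, the quotients defining
  \<open>eta L\<close> are at most \<open>1 / nu L\<close>, so their supremum dominates each of
  them.\<close>

lemma alpha_diff_le:
  assumes L: "L \<in> Lambda" and x: "x \<in> {0..1}" and y: "y \<in> {0..1}"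
  shows "\<bar>alpha L x - alpha L y\<bar> \<le> eta L * nu L"
proof -
  have "\<bar>alpha L x - alpha L y\<bar> / nu L \<le> 1 / nu L" if "x \<in> {0..1}" "y \<in> {0..1}" for x y
    using nu_bounds[OF L] nu_bounds(2,3)[OF L that(1)] nu_bounds(2,3)[OF L that(2)]
    by (intro divide_right_mono) auto
  then have "bdd_above ((\<lambda>(x, y). \<bar>alpha L x - alpha L y\<bar> / nu L) ` ({0..1} \<times> {0..1}))"
    by (intro bdd_aboveI2[where M = "1 / nu L"]) auto
  then have "\<bar>alpha L x - alpha L y\<bar> / nu L \<le> eta L"
    unfolding eta_def by (rule cSUP_upper2[where x = "(x, y)"]) (use x y in auto)
  then show ?thesis using nu_bounds(1)[OF L] by (simp add: field_simps)
qed

lemma eta_nonneg: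
  assumes L: "L \<in> Lambda"
  shows "0 \<le> eta L"
  using alpha_diff_le[OF L, of 0 0] nu_bounds(1)[OF L] by (simp add: zero_le_mult_iff)

section \<open>Derivatives and Taylor expansion of \<open>F_op f\<close> for continuous
  \<open>f\<close>\<close>

text \<open>Korovkin's form of uniform continuity: where \<open>s\<close> and \<open>x\<close> are
  at least \<open>d\<close> apart, \<open>(s - x)^2 / d^2\<close> is at least 1 and absorbs the
  crude bound \<open>2 * M\<close>.\<close>

lemma quadratic_modulus:
  fixes f :: "real \<Rightarrow> real"
  assumes f: "continuous_on {0..1} f" and e: "0 < e"
  obtains C where "0 \<le> C" "\<And>s x. s \<in> {0..1} \<Longrightarrow> x \<in> {0..1} \<Longrightarrow> \<bar>f s - f x\<bar> \<le> e + C * (s - x)\<^sup>2"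
proof -
  have "uniformly_continuous_on {0..1} f"
    by (rule compact_uniformly_continuous[OF f]) simp
  then obtain d where d: "0 < d"
    and dd: "\<And>s x. s \<in> {0..1} \<Longrightarrow> x \<in> {0..1} \<Longrightarrow> \<bar>s - x\<bar> < d \<Longrightarrow> \<bar>f s - f x\<bar> < e"
    using e unfolding uniformly_continuous_on_def dist_real_def by metis
  have "bounded (f ` {0..1})" by (intro compact_imp_bounded compact_continuous_image f) simp
  then obtain M where M: "\<And>x. x \<in> {0..1} \<Longrightarrow> \<bar>f x\<bar> \<le> M"
    unfolding bounded_iff by (metis imageI real_norm_def)
  have M0: "0 \<le> M" using M[of 0] by simp
  show ?thesis
  proof
    show "0 \<le> 2 * M / d\<^sup>2" using M0 by simp
    fix s x :: real assume sx: "s \<in> {0..1}" "x \<in> {0..1}"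
    show "\<bar>f s - f x\<bar> \<le> e + 2 * M / d\<^sup>2 * (s - x)\<^sup>2"
    proof (cases "\<bar>s - x\<bar> < d")
      case True
      moreover have "0 \<le> 2 * M / d\<^sup>2 * (s - x)\<^sup>2" using M0 by simp
      ultimately show ?thesis using dd[OF sx] by linarith
    next
      case False
      then have "d\<^sup>2 \<le> (s - x)\<^sup>2" using d by (metis abs_le_square_iff abs_of_pos not_less)
      then have "2 * M * 1 \<le> 2 * M * ((s - x)\<^sup>2 / d\<^sup>2)"
        using d M0 by (intro mult_left_mono) (auto simp: field_simps)
      then show ?thesis using M[OF sx(1)] M[OF sx(2)] e by (simp add: algebra_simps)
    qed
  qed
qed

text \<open>\<open>F_op\<close> is integration against the Green kernel of \<open>- u'' = f\<close>
  with zero boundary values. Derivatives are taken within the closed interval, hence one-sided at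
  its ends.\<close>

lemma F_op_has_derivative:
  fixes f :: "real \<Rightarrow> real"
  assumes f: "continuous_on {0..1} f"
  obtains F' where
    "\<And>x. x \<in> {0..1} \<Longrightarrow> (F_op f has_real_derivative F' x) (at x within {0..1})"
    "\<And>x. x \<in> {0..1} \<Longrightarrow> (F' has_real_derivative - f x) (at x within {0..1})"
proof -
  define P where "P = (\<lambda>x. integral {0..x} (\<lambda>t. t * f t))"
  define Q where "Q = (\<lambda>x. integral {0..x} (\<lambda>t. (1 - t) * f t))"
  have cont: "continuous_on {0..1} (\<lambda>t. t * f t)" "continuous_on {0..1} (\<lambda>t. (1 - t) * f t)"
    by (auto intro!: continuous_intros f)
  have dP: "(P has_real_derivative x * f x) (at x within {0..1})" if "x \<in> {0..1}" for x
    unfolding P_def by (rule integral_has_real_derivative[OF cont(1) that])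
  have dQ: "(Q has_real_derivative (1 - x) * f x) (at x within {0..1})" if "x \<in> {0..1}" for x
    unfolding Q_def by (rule integral_has_real_derivative[OF cont(2) that])
  \<comment> \<open>Both integrals now start at 0, so the fundamental theorem applies to each; on
    differentiating, the two terms containing \<open>f\<close> cancel.\<close>
  have eq: "F_op f x = (1 - x) * P x + x * (Q 1 - Q x)" if x: "x \<in> {0..1}" for x
  proof -
    have "Q x + integral {x..1} (\<lambda>t. (1 - t) * f t) = Q 1"
      unfolding Q_def using x cont(2)
      by (intro Henstock_Kurzweil_Integration.integral_combine integrable_continuous_real) auto
    then have "integral {x..1} (\<lambda>t. (1 - t) * f t) = Q 1 - Q x" by linarith
    then show ?thesis by (simp add: F_op_def P_def)
  qed
  show ?thesis
  proof (rule that[of "\<lambda>x. Q 1 - Q x - P x"])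
    fix x :: real assume x: "x \<in> {0..1}"
    have "((\<lambda>x. (1 - x) * P x + x * (Q 1 - Q x)) has_real_derivative Q 1 - Q x - P x)
        (at x within {0..1})"
      by (rule derivative_eq_intros dP[OF x] dQ[OF x] refl)+ (simp add: algebra_simps)
    then show "(F_op f has_real_derivative Q 1 - Q x - P x) (at x within {0..1})"
      by (rule has_field_derivative_transform_within[where d = 1]) (use x eq in auto)
    show "((\<lambda>x. Q 1 - Q x - P x) has_real_derivative - f x) (at x within {0..1})"
      by (rule derivative_eq_intros dP[OF x] dQ[OF x] refl)+ (simp add: algebra_simps)
  qed
qed

text \<open>The remainder \<open>D\<close> and its derivative vanish at \<open>x\<close>, and its
  second derivative at \<open>s\<close> is \<open>2 * (f x - f s)\<close>. The quadratic modulus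
  bounds this between \<open>x\<close> and \<open>t\<close>, and two mean value estimates give the
  claim. The constant \<open>C\<close> serves all \<open>x\<close> at once.\<close>

lemma F_op_Taylor:
  fixes f :: "real \<Rightarrow> real"
  assumes f: "continuous_on {0..1} f" and e: "0 < e"
  obtains C a where "0 \<le> C"
    "\<And>x t. x \<in> {0..1} \<Longrightarrow> t \<in> {0..1} \<Longrightarrow>
      \<bar>2 * F_op f t - 2 * F_op f x - a x * (t - x) + f x * (t - x)\<^sup>2\<bar>
        \<le> e * (t - x)\<^sup>2 + C * (t - x) ^ 4"
proof -
  obtain C where C: "0 \<le> C"
    and mod: "\<And>s x. s \<in> {0..1} \<Longrightarrow> x \<in> {0..1} \<Longrightarrow> \<bar>f s - f x\<bar> \<le> e / 2 + C * (s - x)\<^sup>2"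
    using quadratic_modulus[OF f, of "e / 2"] e by auto
  obtain F' where F': "\<And>x. x \<in> {0..1} \<Longrightarrow> (F_op f has_real_derivative F' x) (at x within {0..1})"
    and F'': "\<And>x. x \<in> {0..1} \<Longrightarrow> (F' has_real_derivative - f x) (at x within {0..1})"
    using F_op_has_derivative[OF f] by blast
  have "\<bar>2 * F_op f t - 2 * F_op f x - 2 * F' x * (t - x) + f x * (t - x)\<^sup>2\<bar>
        \<le> e * (t - x)\<^sup>2 + 2 * C * (t - x) ^ 4" if x: "x \<in> {0..1}" and t: "t \<in> {0..1}" for x t
  proof -
    \<comment> \<open>The segment covers both orders of \<open>x\<close> and \<open>t\<close>; on it
      \<open>(s - x)^2\<close> is at most \<open>(t - x)^2\<close>, so \<open>K\<close> below is
      constant in \<open>s\<close>.\<close>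
    define I where "I = closed_segment x t"
    have I: "I \<subseteq> {0..1}" "convex I" "x \<in> I" "t \<in> I"
      using x t unfolding I_def by (auto simp: closed_segment_eq_real_ivl split: if_splits)
    have dist: "\<bar>s - x\<bar> \<le> \<bar>t - x\<bar>" if "s \<in> I" for s
      using that unfolding I_def by (auto simp: closed_segment_eq_real_ivl split: if_splits)
    define K where "K = e + 2 * C * (t - x)\<^sup>2"
    define D where "D = (\<lambda>s. 2 * F_op f s - 2 * F_op f x - 2 * F' x * (s - x) + f x * (s - x)\<^sup>2)"
    define D' where "D' = (\<lambda>s. 2 * F' s - 2 * F' x + 2 * f x * (s - x))"
    have dD: "(D has_real_derivative D' s) (at s within I)" if "s \<in> I" for s
    proof -
      have "(F_op f has_real_derivative F' s) (at s within I)"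
        using F'[of s] that I(1) by (blast intro: DERIV_subset)
      then show ?thesis unfolding D_def D'_def
        by (auto intro!: derivative_eq_intros simp: algebra_simps)
    qed
    have dD': "(D' has_real_derivative 2 * f x - 2 * f s) (at s within I)" if "s \<in> I" for s
    proof -
      have "(F' has_real_derivative - f s) (at s within I)"
        using F''[of s] that I(1) by (blast intro: DERIV_subset)
      then show ?thesis unfolding D'_def
        by (auto intro!: derivative_eq_intros simp: algebra_simps)
    qed
    have K: "norm (2 * f x - 2 * f s) \<le> K" if s: "s \<in> I" for s
    proof -
      have "(s - x)\<^sup>2 \<le> (t - x)\<^sup>2" using dist[OF s] by (simp add: abs_le_square_iff)
      then have "C * (s - x)\<^sup>2 \<le> C * (t - x)\<^sup>2" using C by (rule mult_left_mono)
      then show ?thesis using mod[of s x] s I x unfolding K_def by (auto simp: abs_le_iff)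
    qed
    have K0: "0 \<le> K" using K[OF I(3)] by simp
    have "norm (D' s) \<le> K * \<bar>t - x\<bar>" if s: "s \<in> I" for s
    proof -
      have "norm (D' s - D' x) \<le> K * norm (s - x)"
        by (rule field_differentiable_bound[OF I(2) dD' K s I(3)])
      also have "\<dots> \<le> K * \<bar>t - x\<bar>" using dist[OF s] K0 by (simp add: mult_left_mono)
      finally show ?thesis by (simp add: D'_def)
    qed
    then have "norm (D t - D x) \<le> K * \<bar>t - x\<bar> * norm (t - x)"
      by (intro field_differentiable_bound[OF I(2) dD _ I(4,3)])
    moreover have "D x = 0" by (simp add: D_def)
    moreover have "K * \<bar>t - x\<bar> * norm (t - x) = K * (t - x)\<^sup>2"
      by (simp add: power2_eq_square mult.assoc)
    then have "K * \<bar>t - x\<bar> * norm (t - x) = e * (t - x)\<^sup>2 + 2 * C * (t - x) ^ 4"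
      by (simp add: K_def distrib_right flip: power_add)
    ultimately show ?thesis unfolding D_def by simp
  qed
  with C show ?thesis by (intro that[of "2 * C" "\<lambda>x. 2 * F' x"]) auto
qed

section \<open>Bounds on \<open>F_op\<close>\<close>

text \<open>\<open>f\<close> may oscillate at the endpoints, so the argument is that a bounded
  measurable function on the open interval is integrable; the two endpoints do not affect the
  integral.\<close>

lemma bounded_Copen_integrable:
  fixes f p :: "real \<Rightarrow> real"
  assumes f: "f \<in> B01 \<inter> Copen" and p: "continuous_on {0..1} p" and ab: "0 \<le> a" "b \<le> 1"
  shows "(\<lambda>t. p t * f t) integrable_on {a..b}"
proof -
  obtain M where M: "\<And>x. x \<in> {0..1} \<Longrightarrow> \<bar>f x\<bar> \<le> M"
    using f by (auto simp: B01_iff simp del: atLeastAtMost_iff)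
  have "bounded (p ` {0..1})" by (intro compact_imp_bounded compact_continuous_image p) simp
  then obtain N where N: "\<And>x. x \<in> {0..1} \<Longrightarrow> \<bar>p x\<bar> \<le> N"
    unfolding bounded_iff by (metis imageI real_norm_def)
  have cont: "continuous_on {0<..<1} (\<lambda>t. p t * f t)"
    using f p unfolding Copen_def by (auto intro!: continuous_intros elim: continuous_on_subset)
  have "(\<lambda>t. p t * f t) integrable_on {0<..<1}"
  proof (rule measurable_bounded_by_integrable_imp_integrable_real)
    show "(\<lambda>t. p t * f t) \<in> borel_measurable (lebesgue_on {0<..<1})"
      using cont by (rule continuous_imp_measurable_on_sets_lebesgue) simp
    show "(\<lambda>_. N * M) integrable_on {0<..<(1::real)}"
      by (simp add: integrable_on_open_interval_real integrable_const_ivl)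
    show "\<bar>p t * f t\<bar> \<le> N * M" if "t \<in> {0<..<1}" for t
      using that M[of t] N[of t] by (auto simp: abs_mult intro!: mult_mono)
  qed simp
  then have "(\<lambda>t. p t * f t) integrable_on {0..1}"
    by (simp add: integrable_on_open_interval_real)
  then show ?thesis by (rule integrable_on_subinterval) (use ab in auto)
qed

lemma C01_imp_B01_Copen: "continuous_on {0..1} f \<Longrightarrow> f \<in> B01 \<inter> Copen"
  unfolding B01_def Copen_def
  by (auto intro: compact_imp_bounded compact_continuous_image elim: continuous_on_subset)

text \<open>The kernel of \<open>F_op\<close> is at most \<open>psi x\<close>: the factor
  \<open>t\<close> is at most \<open>x\<close> on the left piece, and \<open>1 - t\<close> is at
  most \<open>1 - x\<close> on the right piece.\<close>

lemma F_op_diff_le: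
  fixes f g p :: "real \<Rightarrow> real"
  assumes f: "f \<in> B01 \<inter> Copen" and g: "g \<in> B01 \<inter> Copen" and p: "continuous_on {0..1} p"
    and le: "\<And>t. t \<in> {0..1} \<Longrightarrow> \<bar>f t - g t\<bar> \<le> p t" and x: "x \<in> {0..1}"
  shows "\<bar>F_op f x - F_op g x\<bar> \<le> integral {0..1} p * psi x"
proof -
  let ?A = "integral {0..x} (\<lambda>t. t * f t) - integral {0..x} (\<lambda>t. t * g t)"
  let ?B = "integral {x..1} (\<lambda>t. (1 - t) * f t) - integral {x..1} (\<lambda>t. (1 - t) * g t)"
  have pint: "p integrable_on {a..b}" if "0 \<le> a" "b \<le> 1" for a b
    by (rule integrable_continuous_real, rule continuous_on_subset[OF p]) (use that in auto)
  have int: "(\<lambda>t. t * f t) integrable_on {a..b}" "(\<lambda>t. t * g t) integrable_on {a..b}"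
      "(\<lambda>t. (1 - t) * f t) integrable_on {a..b}" "(\<lambda>t. (1 - t) * g t) integrable_on {a..b}"
    if "0 \<le> a" "b \<le> 1" for a b
    using that by (auto intro!: bounded_Copen_integrable f g continuous_intros)
  have "\<bar>?A\<bar> = norm (integral {0..x} (\<lambda>t. t * f t - t * g t))"
    using int x by (simp add: Henstock_Kurzweil_Integration.integral_diff)
  also have "\<dots> \<le> integral {0..x} (\<lambda>t. x * p t)"
  proof (rule integral_norm_bound_integral)
    show "norm (t * f t - t * g t) \<le> x * p t" if "t \<in> {0..x}" for t
      using that x le[of t] by (auto simp: abs_mult intro!: mult_mono simp flip: right_diff_distrib)
  qed (use x int pint in \<open>auto intro!: integrable_diff integrable_on_mult_right\<close>)
  finally have A: "\<bar>?A\<bar> \<le> x * integral {0..x} p" by simp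
  have "\<bar>?B\<bar> = norm (integral {x..1} (\<lambda>t. (1 - t) * f t - (1 - t) * g t))"
    using int x by (simp add: Henstock_Kurzweil_Integration.integral_diff)
  also have "\<dots> \<le> integral {x..1} (\<lambda>t. (1 - x) * p t)"
  proof (rule integral_norm_bound_integral)
    show "norm ((1 - t) * f t - (1 - t) * g t) \<le> (1 - x) * p t" if "t \<in> {x..1}" for t
      using that x le[of t] by (auto simp: abs_mult intro!: mult_mono simp flip: right_diff_distrib)
  qed (use x int pint in \<open>auto intro!: integrable_diff integrable_on_mult_right\<close>)
  finally have B: "\<bar>?B\<bar> \<le> (1 - x) * integral {x..1} p" by simp
  have "F_op f x - F_op g x = (1 - x) * ?A + x * ?B"
    by (simp add: F_op_def algebra_simps)
  then have "\<bar>F_op f x - F_op g x\<bar> \<le> (1 - x) * \<bar>?A\<bar> + x * \<bar>?B\<bar>"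
    using x abs_triangle_ineq[of "(1 - x) * ?A" "x * ?B"] by (simp add: abs_mult)
  also have "\<dots> \<le> (1 - x) * (x * integral {0..x} p) + x * ((1 - x) * integral {x..1} p)"
    using x by (auto intro: add_mono[OF mult_left_mono[OF A] mult_left_mono[OF B]])
  also have "\<dots> = (integral {0..x} p + integral {x..1} p) * psi x"
    by (simp add: psi_def algebra_simps)
  also have "integral {0..x} p + integral {x..1} p = integral {0..1} p"
    using x pint by (intro Henstock_Kurzweil_Integration.integral_combine) auto
  finally show ?thesis .
qed

lemma F_op_abs_le:
  fixes f p :: "real \<Rightarrow> real"
  assumes f: "f \<in> B01 \<inter> Copen" and p: "continuous_on {0..1} p"
    and le: "\<And>t. t \<in> {0..1} \<Longrightarrow> \<bar>f t\<bar> \<le> p t" and x: "x \<in> {0..1}"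
  shows "\<bar>F_op f x\<bar> \<le> integral {0..1} p * psi x"
  using F_op_diff_le[OF f C01_imp_B01_Copen[OF continuous_on_const[of _ 0]] p _ x] le
  by (simp add: F_op_def)

lemma F_op_Cpsi:
  assumes f: "continuous_on {0..1} f"
  shows "F_op f \<in> Cpsi"
proof (rule CpsiI)
  obtain F' where "\<And>x. x \<in> {0..1} \<Longrightarrow> (F_op f has_real_derivative F' x) (at x within {0..1})"
    using F_op_has_derivative[OF f] by blast
  then show "continuous_on {0..1} (F_op f)" by (rule DERIV_continuous_on)
  show "\<bar>F_op f x\<bar> \<le> integral {0..1} (\<lambda>t. \<bar>f t\<bar>) * psi x" if "x \<in> {0..1}" for x
    using that by (intro F_op_abs_le C01_imp_B01_Copen f continuous_intros) auto
qed

section \<open>The Voronovskaja estimate and its transfer to the series\<close>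

text \<open>\<open>L\<close> is applied in \<open>t\<close> to the Taylor estimate at the fixed
  point \<open>x\<close> and the result is evaluated at \<open>x\<close>. The affine part is
  preserved, so the slope \<open>a\<close> disappears.\<close>

lemma Voronovskaja_F_op:
  assumes L: "L \<in> Lambda" and f: "continuous_on {0..1} f" and x: "x \<in> {0..1}"
    and Taylor: "\<And>t. t \<in> {0..1} \<Longrightarrow>
      \<bar>2 * F_op f t - 2 * F_op f x - a * (t - x) + f x * (t - x)\<^sup>2\<bar>
        \<le> e * (t - x)\<^sup>2 + C * (t - x) ^ 4"
  shows "\<bar>f x * moment L 2 x - (2 * F_op f x - 2 * L (F_op f) x)\<bar>
    \<le> e * moment L 2 x + C * moment L 4 x"
proof -
  note P = Lambda_plo[OF L]
  have F: "F_op f \<in> C01" by (intro Cpsi_imp_C01 F_op_Cpsi f)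
  define A where "A = (\<lambda>t. (2 * F_op f x - a * x) + a * t)"
  have mem: "(\<lambda>t. 2 * F_op f t) \<in> C01" "A \<in> C01" "(\<lambda>t. 2 * F_op f t - A t) \<in> C01"
      "(\<lambda>t. (t - x)\<^sup>2) \<in> C01" "(\<lambda>t. (t - x) ^ 4) \<in> C01"
      "(\<lambda>t. c * (t - x)\<^sup>2) \<in> C01" "(\<lambda>t. c * (t - x) ^ 4) \<in> C01"
      "(\<lambda>t. e * (t - x)\<^sup>2 + C * (t - x) ^ 4) \<in> C01"
      "(\<lambda>t. (2 * F_op f t - A t) + f x * (t - x)\<^sup>2) \<in> C01" for c
    using F unfolding C01_def A_def by (auto intro!: continuous_intros)
  have m: "L (\<lambda>t. (t - x)\<^sup>2) x = moment L 2 x" "L (\<lambda>t. (t - x) ^ 4) x = moment L 4 x"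
    by (simp_all add: moment_def mono_fun_def)
  have LA: "L A x = 2 * F_op f x"
    unfolding A_def by (simp add: Lambda_affine[OF L x])
  have "\<bar>L (\<lambda>t. (2 * F_op f t - A t) + f x * (t - x)\<^sup>2) x\<bar>
      \<le> L (\<lambda>t. e * (t - x)\<^sup>2 + C * (t - x) ^ 4) x"
    by (rule plo_abs_le[OF P mem(9,8) x]) (use Taylor in \<open>simp add: A_def algebra_simps\<close>)
  then show ?thesis
    unfolding plo_add[OF P mem(3,6) x] plo_add[OF P mem(6,7) x] plo_diff[OF P mem(1,2) x]
      plo_cmult[OF P mem(4) x] plo_cmult[OF P mem(5) x] plo_cmult[OF P F x] m LA
    by (simp add: algebra_simps)
qed

lemma geom_series_estimate:
  assumes L: "L \<in> Lambda" and f: "continuous_on {0..1} f"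
    and M: "\<And>x. x \<in> {0..1} \<Longrightarrow> \<bar>f x\<bar> \<le> M"
    and R: "\<And>x. x \<in> {0..1} \<Longrightarrow>
      \<bar>f x * moment L 2 x - (2 * F_op f x - 2 * L (F_op f) x)\<bar> \<le> r * moment L 2 x"
    and x: "x \<in> {0..1}"
  shows "\<bar>alpha L x * geom_series L (\<lambda>t. psi t * f t) x - 2 * F_op f x\<bar> \<le> (eta L * M + r) * psi x"
proof -
  note P = Lambda_plo[OF L]
  define h where "h = geom_series L (\<lambda>t. psi t * f t)"
  \<comment> \<open>The factor \<open>alpha L x\<close> is frozen at the point of evaluation, so
    that it commutes with \<open>L\<close>.\<close>
  define v where "v = (\<lambda>y. alpha L x * h y - 2 * F_op f y)"
  have g: "(\<lambda>t. psi t * f t) \<in> Cpsi" by (intro Cpsi_psi_mult C01_imp_B01_Copen f)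
  have h: "h \<in> Cpsi" unfolding h_def by (rule geom_series_solves(1)[OF L g])
  have h_eq: "h y - L h y = psi y * f y" if "y \<in> {0..1}" for y
    unfolding h_def by (rule geom_series_solves(2)[OF L g that])
  have F: "F_op f \<in> Cpsi" by (rule F_op_Cpsi[OF f])
  note mem = Cpsi_imp_C01[OF h] Cpsi_imp_C01[OF F] Cpsi_imp_C01[OF Cpsi_cmult[OF h]]
    Cpsi_imp_C01[OF Cpsi_cmult[OF F]]
  have "\<bar>v x\<bar> \<le> (eta L * M + r) * psi x"
  proof (rule Lambda_comparison_abs[OF L _ _ _ x])
    show "v \<in> Cpsi" unfolding v_def by (intro Cpsi_diff Cpsi_cmult h F)
    show "(\<lambda>x. (eta L * M + r) * psi x) \<in> Cpsi" by (intro Cpsi_cmult Cpsi_psi)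
    fix y :: real assume y: "y \<in> {0..1}"
    have m: "moment L 2 y = alpha L y * psi y"
      by (simp add: Lambda_moment2[OF L y] alpha_mult_psi[OF L y])
    have "v y - L v y = alpha L x * (h y - L h y) - (2 * F_op f y - 2 * L (F_op f) y)"
      unfolding v_def plo_diff[OF P mem(3,4) y] plo_cmult[OF P mem(1) y] plo_cmult[OF P mem(2) y]
      by (simp add: algebra_simps)
    \<comment> \<open>Unfreezing the factor turns the source \<open>alpha L y * psi y * f y\<close>
      into \<open>f y\<close> times the second moment, which the Voronovskaja estimate handles. Both
      remaining errors are multiples of \<open>alpha L * psi = psi - L psi\<close>.\<close>
    also have "\<dots> = (alpha L x - alpha L y) * (psi y * f y)
        + (f y * moment L 2 y - (2 * F_op f y - 2 * L (F_op f) y))"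
      unfolding h_eq[OF y] m by (simp add: algebra_simps)
    also have "\<bar>\<dots>\<bar> \<le> (eta L * alpha L y) * (psi y * M) + r * moment L 2 y"
    proof (rule order_trans[OF abs_triangle_ineq add_mono[OF _ R[OF y]]])
      have "\<bar>alpha L x - alpha L y\<bar> \<le> eta L * nu L" by (rule alpha_diff_le[OF L x y])
      also have "\<dots> \<le> eta L * alpha L y"
        by (intro mult_left_mono nu_bounds[OF L] eta_nonneg[OF L] y)
      finally have a: "\<bar>alpha L x - alpha L y\<bar> \<le> eta L * alpha L y" .
      have b: "\<bar>psi y * f y\<bar> \<le> psi y * M"
        using M[OF y] psi_nonneg[OF y] by (simp add: abs_mult mult_left_mono)
      show "\<bar>(alpha L x - alpha L y) * (psi y * f y)\<bar> \<le> (eta L * alpha L y) * (psi y * M)"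
        unfolding abs_mult[of "alpha L x - alpha L y"] by (rule mult_mono[OF a b]) (use a in auto)
    qed
    also have "\<dots> = (eta L * M + r) * (psi y - L psi y)"
      unfolding m alpha_mult_psi[OF L y, symmetric] by (simp add: algebra_simps)
    also have "\<dots> = (eta L * M + r) * psi y - L (\<lambda>x. (eta L * M + r) * psi x) y"
      unfolding plo_cmult[OF P C01_psi y] by (simp add: algebra_simps)
    finally show "\<bar>v y - L v y\<bar> \<le> (eta L * M + r) * psi y - L (\<lambda>x. (eta L * M + r) * psi x) y" .
  qed
  then show ?thesis by (simp add: v_def h_def)
qed

text \<open>Monotonicity of the series: \<open>I - L\<close> maps the two sides to
  \<open>psi * (f - g)\<close> and \<open>M * psi * p\<close>, so the maximum principle applies.
  Continuity at the endpoints is not involved.\<close>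

lemma geom_series_diff_le:
  assumes L: "L \<in> Lambda"
    and f: "f \<in> B01 \<inter> Copen" and g: "g \<in> B01 \<inter> Copen" and p: "p \<in> B01 \<inter> Copen"
    and le: "\<And>t. t \<in> {0..1} \<Longrightarrow> \<bar>f t - g t\<bar> \<le> M * p t" and x: "x \<in> {0..1}"
  shows "\<bar>geom_series L (\<lambda>t. psi t * f t) x - geom_series L (\<lambda>t. psi t * g t) x\<bar>
    \<le> M * geom_series L (\<lambda>t. psi t * p t) x"
proof -
  note P = Lambda_plo[OF L]
  note S = geom_series_solves(1)[OF L Cpsi_psi_mult] and E = geom_series_solves(2)[OF L Cpsi_psi_mult]
  show ?thesis
  proof (rule Lambda_comparison_abs[OF L Cpsi_diff[OF S[OF f] S[OF g]] Cpsi_cmult[OF S[OF p]] _ x])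
    fix y :: real assume y: "y \<in> {0..1}"
    note [simp] = plo_diff[OF P Cpsi_imp_C01[OF S[OF f]] Cpsi_imp_C01[OF S[OF g]] y]
      plo_cmult[OF P Cpsi_imp_C01[OF S[OF p]] y]
    let ?f = "geom_series L (\<lambda>t. psi t * f t)" and ?g = "geom_series L (\<lambda>t. psi t * g t)"
      and ?p = "geom_series L (\<lambda>t. psi t * p t)"
    have "?f y - ?g y - L (\<lambda>x. ?f x - ?g x) y = psi y * (f y - g y)"
      using E[OF f y] E[OF g y] by (simp add: algebra_simps)
    moreover have "M * ?p y - L (\<lambda>x. M * ?p x) y = psi y * (M * p y)"
      using E[OF p y] by (simp flip: right_diff_distrib)
    moreover have "\<bar>psi y * (f y - g y)\<bar> \<le> psi y * (M * p y)"
      using le[OF y] psi_nonneg[OF y] by (simp add: abs_mult mult_left_mono)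
    ultimately show "\<bar>?f y - ?g y - L (\<lambda>x. ?f x - ?g x) y\<bar> \<le> M * ?p y - L (\<lambda>x. M * ?p x) y"
      by simp
  qed
qed

section \<open>The cut-off integral and the continuous case\<close>

text \<open>Evaluated through an explicit primitive; the value tends to 0 as \<open>m\<close> grows,
  which makes the part cut off near the endpoints negligible.\<close>

lemma integral_even_power: "integral {0..1} (\<lambda>t::real. (1 - 2 * t) ^ (2 * m)) = 1 / (2 * real m + 1)"
proof -
  define N where "N = 2 * real m + 1"
  have N: "0 < N" "real (Suc (2 * m)) = N" by (simp_all add: N_def)
  define G where "G = (\<lambda>t::real. (1 - 2 * t) ^ Suc (2 * m) * (- 1 / (2 * N)))"
  have "(G has_real_derivative (1 - 2 * x) ^ (2 * m)) (at x within {0..1})" for x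
  proof -
    have "((\<lambda>t::real. 1 - 2 * t) has_real_derivative - 2) (at x within {0..1})"
      by (auto intro!: derivative_eq_intros)
    from DERIV_power_Suc[OF this, of "2 * m"]
    have "((\<lambda>t::real. (1 - 2 * t) ^ Suc (2 * m)) has_real_derivative
        N * ((- 2) * (1 - 2 * x) ^ (2 * m))) (at x within {0..1})"
      by (simp add: N_def add.commute del: power_Suc)
    from DERIV_cmult_right[OF this, of "- 1 / (2 * N)"] show ?thesis
      using N(1) by (simp add: G_def del: power_Suc)
  qed
  then have "((\<lambda>t::real. (1 - 2 * t) ^ (2 * m)) has_integral G 1 - G 0) {0..1}"
    by (intro fundamental_theorem_of_calculus)
       (auto simp flip: has_real_derivative_iff_has_vector_derivative)
  moreover have "G 1 - G 0 = 1 / N" using N(1) by (simp add: G_def field_simps)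
  ultimately show ?thesis by (simp add: integral_unique N_def)
qed

lemma geom_series_tendsto_continuous:
  fixes L :: "nat \<Rightarrow> (real \<Rightarrow> real) \<Rightarrow> (real \<Rightarrow> real)"
  assumes L: "\<And>n. L n \<in> Lambda"
    and b: "\<beta> \<longlonglongrightarrow> 0"
    and m4: "\<forall>n. \<forall>x\<in>{0..1}. moment (L n) 4 x \<le> \<beta> n * moment (L n) 2 x"
    and eta: "(\<lambda>n. eta (L n)) \<longlonglongrightarrow> 0"
    and f: "continuous_on {0..1} f" and e: "0 < e"
  shows "\<forall>\<^sub>F n in sequentially. \<forall>x\<in>{0..1}.
    \<bar>alpha (L n) x * geom_series (L n) (\<lambda>t. psi t * f t) x - 2 * F_op f x\<bar> \<le> e * psi x"
proof -
  obtain M where M: "\<And>x. x \<in> {0..1} \<Longrightarrow> \<bar>f x\<bar> \<le> M"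
    using C01_imp_B01_Copen[OF f] by (auto simp: B01_iff simp del: atLeastAtMost_iff)
  obtain C a where C: "0 \<le> C"
    and T: "\<And>x t. x \<in> {0..1} \<Longrightarrow> t \<in> {0..1} \<Longrightarrow>
      \<bar>2 * F_op f t - 2 * F_op f x - a x * (t - x) + f x * (t - x)\<^sup>2\<bar>
        \<le> e / 2 * (t - x)\<^sup>2 + C * (t - x) ^ 4"
    using F_op_Taylor[OF f, of "e / 2"] e by auto
  \<comment> \<open>The Taylor estimate was taken with \<open>e / 2\<close>, so the error constant
    tends to \<open>e / 2\<close> and is eventually below \<open>e\<close>.\<close>
  have "(\<lambda>n. eta (L n) * M + (e / 2 + C * \<beta> n)) \<longlonglongrightarrow> 0 * M + (e / 2 + C * 0)"
    by (intro tendsto_intros b eta)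
  then have "\<forall>\<^sub>F n in sequentially. eta (L n) * M + (e / 2 + C * \<beta> n) < e"
    by (rule order_tendstoD) (use e in auto)
  then show ?thesis
  proof eventually_elim
    case (elim n)
    show ?case
    proof
      fix x :: real assume x: "x \<in> {0..1}"
      have "\<bar>f x * moment (L n) 2 x - (2 * F_op f x - 2 * L n (F_op f) x)\<bar>
          \<le> (e / 2 + C * \<beta> n) * moment (L n) 2 x" if x: "x \<in> {0..1}" for x
        using Voronovskaja_F_op[OF L[of n] f x T[OF x]] mult_left_mono[OF m4[THEN spec, THEN bspec, OF x] C, of n]
        by (simp add: algebra_simps)
      from geom_series_estimate[OF L f M this x]
      have "\<bar>alpha (L n) x * geom_series (L n) (\<lambda>t. psi t * f t) x - 2 * F_op f x\<bar>
          \<le> (eta (L n) * M + (e / 2 + C * \<beta> n)) * psi x" .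
      also have "\<dots> \<le> e * psi x" using elim psi_nonneg[OF x] by (intro mult_right_mono) auto
      finally show "\<bar>alpha (L n) x * geom_series (L n) (\<lambda>t. psi t * f t) x - 2 * F_op f x\<bar>
          \<le> e * psi x" .
    qed
  qed
qed

section \<open>The general case by cutting off at the endpoints\<close>

theorem theorem4:
  fixes L :: "nat \<Rightarrow> (real \<Rightarrow> real) \<Rightarrow> (real \<Rightarrow> real)"
    and f :: "real \<Rightarrow> real"
  assumes "\<And>n. L n \<in> Lambda"
    and "\<exists>\<beta> :: nat \<Rightarrow> real. (\<forall>n. \<beta> n > 0) \<and> \<beta> \<longlonglongrightarrow> 0 \<and>
           (\<forall>n. \<forall>x\<in>{0..1}. moment (L n) 4 x \<le> \<beta> n * moment (L n) 2 x)"
    and "(\<lambda>n. eta (L n)) \<in> o(\<lambda>_. 1)"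
    and "f \<in> B01 \<inter> Copen"
  shows "(\<lambda>n. psi_norm (\<lambda>x. alpha (L n) x * geom_series (L n) (\<lambda>t. psi t * f t) x
            - 2 * F_op f x)) \<longlonglongrightarrow> 0"
proof -
  note L = assms(1) and f = assms(4)
  obtain \<beta> :: "nat \<Rightarrow> real" where b: "\<beta> \<longlonglongrightarrow> 0"
    and m4: "\<forall>n. \<forall>x\<in>{0..1}. moment (L n) 4 x \<le> \<beta> n * moment (L n) 2 x"
    using assms(2) by blast
  have eta: "(\<lambda>n. eta (L n)) \<longlonglongrightarrow> 0"
    using smalloD_tendsto[OF assms(3)] by simp
  note lim = geom_series_tendsto_continuous[OF L b m4 eta]
  obtain M where M: "\<And>x. x \<in> {0..1} \<Longrightarrow> \<bar>f x\<bar> \<le> M"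
    using f by (auto simp: B01_iff simp del: atLeastAtMost_iff)
  have M0: "0 \<le> M" using M[of 0] by simp
  have ev: "\<forall>\<^sub>F n in sequentially. \<forall>x\<in>{0..1}.
      \<bar>alpha (L n) x * geom_series (L n) (\<lambda>t. psi t * f t) x - 2 * F_op f x\<bar> \<le> e * psi x"
    if e: "0 < e" for e
  proof -
    \<comment> \<open>The continuous case is used for \<open>g\<close> with weight 1 and for
      \<open>p\<close> with weight \<open>M\<close>; this \<open>d\<close> makes their joint error
      \<open>e / 2\<close>.\<close>
    define d where "d = e / (2 * (1 + M))"
    have d: "0 < d" "(1 + M) * d = e / 2" using e M0 by (auto simp: d_def field_simps)
    \<comment> \<open>The other half of \<open>e\<close> pays for \<open>4 * M * J\<close>, where
      \<open>J\<close> is \<open>1 / (2 * m + 1)\<close>.\<close>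
    obtain m :: nat where m: "4 * M / e < real m"
      using reals_Archimedean2 by blast
    define p where "p = (\<lambda>t::real. (1 - 2 * t) ^ (2 * m))"
    \<comment> \<open>As \<open>p\<close> is 1 at both endpoints, \<open>g\<close> is dominated by
      \<open>M * (1 - p)\<close> and tends to 0 there.\<close>
    define g where "g = (\<lambda>t. f t * (1 - p t))"
    have p: "continuous_on {0..1} p" unfolding p_def by (intro continuous_intros)
    have p01: "0 \<le> p t \<and> p t \<le> 1" if "t \<in> {0..1}" for t
    proof -
      have "(1 - 2 * t)\<^sup>2 \<le> 1" using that abs_square_le_1[of "1 - 2 * t"] by (auto simp: abs_le_iff)
      then show ?thesis unfolding p_def power_mult by (auto intro: power_le_one)
    qed
    have g: "continuous_on {0..1} g"
    proof (rule continuous_on_Icc_by_majorant[where w = "\<lambda>t. M * (1 - p t)"])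
      show "continuous_on {0<..<1} g"
        using f p unfolding g_def Copen_def
        by (auto intro!: continuous_intros elim: continuous_on_subset)
      show "\<bar>g t\<bar> \<le> M * (1 - p t)" if "t \<in> {0..1}" for t
        using M[OF that] p01[OF that] by (simp add: g_def abs_mult mult_right_mono)
    qed (auto simp: p_def intro!: continuous_intros)
    have fg: "\<bar>f t - g t\<bar> \<le> M * p t" if "t \<in> {0..1}" for t
    proof -
      have "f t - g t = f t * p t" by (simp add: g_def algebra_simps)
      then show ?thesis using M[OF that] p01[OF that] by (simp add: abs_mult mult_right_mono)
    qed
    define J where "J = integral {0..1} p"
    have "4 * M < e * real m" using m e by (simp add: field_simps)
    then have "4 * M \<le> e / 2 * (2 * real m + 1)" using e by (simp add: algebra_simps)
    then have J: "4 * M * J \<le> e / 2"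
      unfolding J_def p_def integral_even_power by (simp add: divide_le_eq)
    show ?thesis
      using lim[OF g d(1)] lim[OF p d(1)]
    proof eventually_elim
      case (elim n)
      show ?case
      proof
        fix x :: real assume x: "x \<in> {0..1}"
        let ?G = "\<lambda>u. geom_series (L n) (\<lambda>t. psi t * u t) x"
        let ?a = "alpha (L n) x"
        note pB = C01_imp_B01_Copen[OF p] and gB = C01_imp_B01_Copen[OF g]
        have a: "0 \<le> ?a" using nu_bounds[OF L[of n]] x by (meson less_imp_le order_trans)
        have "\<bar>F_op p x\<bar> \<le> J * psi x"
          unfolding J_def by (rule F_op_abs_le[OF pB p _ x]) (use p01 in auto)
        moreover have "?a * ?G p - 2 * F_op p x \<le> d * psi x"
          using elim(2) x by (auto simp: abs_le_iff)
        ultimately have "?a * ?G p \<le> (d + 2 * J) * psi x"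
          by (simp add: distrib_right)
        then have "M * (?a * ?G p) \<le> M * ((d + 2 * J) * psi x)"
          using M0 by (rule mult_left_mono)
        moreover have "\<bar>?a * ?G f - ?a * ?G g\<bar> \<le> M * (?a * ?G p)"
        proof -
          have "\<bar>?a * ?G f - ?a * ?G g\<bar> = ?a * \<bar>?G f - ?G g\<bar>"
            using a by (simp add: abs_mult flip: right_diff_distrib)
          also have "\<dots> \<le> ?a * (M * ?G p)"
            by (intro mult_left_mono a geom_series_diff_le[OF L f gB pB fg x])
          finally show ?thesis by (simp add: mult_ac)
        qed
        ultimately have 1: "\<bar>?a * ?G f - ?a * ?G g\<bar> \<le> M * ((d + 2 * J) * psi x)" by linarith
        have 2: "\<bar>F_op f x - F_op g x\<bar> \<le> M * J * psi x"
          using F_op_diff_le[OF f gB _ fg x] p by (simp add: J_def continuous_intros)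
        have 3: "\<bar>?a * ?G g - 2 * F_op g x\<bar> \<le> d * psi x" using elim(1) x by blast
        \<comment> \<open>Of \<open>4 * M * J\<close>, one half comes from the series of
          \<open>p\<close> and the other from twice the difference of \<open>F_op f\<close> and
          \<open>F_op g\<close>.\<close>
        have "\<bar>?a * ?G f - 2 * F_op f x\<bar> \<le> ((1 + M) * d + 4 * M * J) * psi x"
          using 1 2 3 by (simp add: algebra_simps abs_le_iff)
        also have "\<dots> \<le> e * psi x"
          using d(2) J by (intro mult_right_mono psi_nonneg x) auto
        finally show "\<bar>?a * ?G f - 2 * F_op f x\<bar> \<le> e * psi x" .
      qed
    qed
  qed
  show ?thesis
  proof (rule LIMSEQ_I)
    fix r :: real assume r: "0 < r"
    from r have "0 < r / 2" by simp
    from ev[OF this] obtain N where N: "\<And>n x. N \<le> n \<Longrightarrow> x \<in> {0..1} \<Longrightarrow>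
      \<bar>alpha (L n) x * geom_series (L n) (\<lambda>t. psi t * f t) x - 2 * F_op f x\<bar> \<le> r / 2 * psi x"
      unfolding eventually_sequentially by blast
    show "\<exists>N. \<forall>n\<ge>N. norm (psi_norm (\<lambda>x. alpha (L n) x * geom_series (L n) (\<lambda>t. psi t * f t) x
            - 2 * F_op f x) - 0) < r"
    proof (intro exI allI impI)
      fix n assume n: "N \<le> n"
      let ?w = "\<lambda>x. alpha (L n) x * geom_series (L n) (\<lambda>t. psi t * f t) x - 2 * F_op f x"
      have "\<bar>?w x\<bar> \<le> r / 2 * psi x" if "x \<in> {0<..<1}" for x
        using N[OF n, of x] that by simp
      from psi_norm_le[of ?w, OF this] r show "norm (psi_norm ?w - 0) < r" by simp
    qed
  qed
qed

end
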